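(* For every integer $k\ge 2$, there exists an infinite family $\mathcal{D}$ of $(2k-1)$-arc-strong digraphs such that every $D\in\mathcal{D}$ has the following properties: (i) $D$ is obtained from a semicomplete digraph $S$ by deleting all arcs corresponding to a path of length at least $2k$ in the underlying complete graph of $S$; that is, there is a path $P$ with at least $2k$ edges in the complete graph on $V(S)$ such that $V(D)=V(S)$ and $D$ is obtained from $S$ by deleting, for each edge $xy$ of $P$, every arc of $S$ between $x$ and $y$ (in either direction); (ii) $D$ has no spanning $k$-arc-strong oriented subdigraph; (iii) $V(D)$ can be partitioned into two sets each of which induces a semicomplete digraph.
   Context: Digraphs are finite, without loops and without parallel arcs; both arcs $xy$ and $yx$ may be present (they then form a directed 2-cycle). An infinite family of digraphs means one containing infinitely many pairwise non-isomorphic digraphs. A digraph $D$ is semicomplete if for every pair of distinct vertices $x,y$ at least one of the arcs $xy,yx$ is present. An oriented graph is a digraph with no directed 2-cycle; a spanning oriented subdigraph of $D$ is a subdigraph with vertex set $V(D)$ that is an oriented graph. For a positive integer $k$, a digraph $D$ is $k$-arc-strong if it remains strongly connected after the removal of any subset of $k-1$ arcs; equivalently, for every set $X$ with $\varnothing\ne X\subsetneq V(D)$, the number $d_D^-(X)$ of arcs $xy\in A(D)$ with $x\notin X$ and $y\in X$ is at least $k$. The length of a path is its number of edges; paths have no repeated vertices. *)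

theory Defs
  imports Graph_Theory.Graph_Theory
begin

text \<open>
  Finite digraphs without loops and without parallel arcs are those of locale \<open>digraph\<close>.
  Concrete ones are given as \<open>pair_pre_digraph\<close> records, whose arcs are ordered pairs of
  vertices; \<open>with_proj\<close> is the (declared) coercion into general digraphs.
\<close>

definition semicomplete :: "('a, 'b) pre_digraph \<Rightarrow> bool" where
  "semicomplete G \<longleftrightarrow> digraph G \<and>
     (\<forall>x \<in> verts G. \<forall>y \<in> verts G. x \<noteq> y \<longrightarrow> x \<rightarrow>\<^bsub>G\<^esub> y \<or> y \<rightarrow>\<^bsub>G\<^esub> x)"

definition oriented_graph :: "('a, 'b) pre_digraph \<Rightarrow> bool" where
  "oriented_graph G \<longleftrightarrow> digraph G \<and> (\<forall>x y. \<not> (x \<rightarrow>\<^bsub>G\<^esub> y \<and> y \<rightarrow>\<^bsub>G\<^esub> x))"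

text \<open>
  Meant for \<open>k \<ge> 1\<close>. All sets of \<^emph>\<open>at most\<close> \<open>k - 1\<close> arcs are removed: with exactly \<open>k - 1\<close>,
  every digraph with fewer arcs than that would qualify vacuously. Equivalence with the
  condition on cuts is lemma \<open>arc_strong_iff_cuts\<close> below.
\<close>

definition arc_strong :: "nat \<Rightarrow> ('a, 'b) pre_digraph \<Rightarrow> bool" where
  "arc_strong k G \<longleftrightarrow> digraph G \<and>
     (\<forall>F \<subseteq> arcs G. card F < k \<longrightarrow> strongly_connected (G\<lparr>arcs := arcs G - F\<rparr>))"

definition complete_graph_on :: "'a set \<Rightarrow> 'a pair_pre_digraph" where
  "complete_graph_on V = \<lparr>pverts = V, parcs = {(x, y). x \<in> V \<and> y \<in> V \<and> x \<noteq> y}\<rparr>"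

text \<open>Removes the arcs in both directions along the vertex sequence \<open>P\<close>.\<close>

definition delete_path_arcs :: "'a pair_pre_digraph \<Rightarrow> 'a vwalk \<Rightarrow> 'a pair_pre_digraph" where
  "delete_path_arcs S P = S\<lparr>parcs := parcs S - symcl (set (vwalk_arcs P))\<rparr>"

definition infinite_family :: "'a pair_pre_digraph set \<Rightarrow> bool" where
  "infinite_family \<D> \<longleftrightarrow>
     (\<exists>\<F> \<subseteq> \<D>. infinite \<F> \<and> pairwise (\<lambda>G H. \<not> digraph_iso (with_proj G) (with_proj H)) \<F>)"

lemma arc_strong_iff_cuts:
  assumes "k \<ge> 1"
  shows "arc_strong k G \<longleftrightarrow> digraph G \<and> verts G \<noteq> {} \<and>
    (\<forall>X. X \<noteq> {} \<and> X \<subset> verts G \<longrightarrow> k \<le> card {a \<in> arcs G. tail G a \<notin> X \<and> head G a \<in> X})"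
    (is "?L \<longleftrightarrow> _ \<and> _ \<and> ?C")
proof (intro iffI conjI)
  assume L: ?L
  then show "digraph G" by (simp add: arc_strong_def)
  have "strongly_connected (G\<lparr>arcs := arcs G - {}\<rparr>)"
    using L assms unfolding arc_strong_def by (elim conjE, drule_tac spec[of _ "{}"]) simp
  then show "verts G \<noteq> {}" by (simp add: strongly_connected_def)
  show ?C
  proof (intro allI impI, rule ccontr)
    fix X assume X: "X \<noteq> {} \<and> X \<subset> verts G"
    let ?F = "{a \<in> arcs G. tail G a \<notin> X \<and> head G a \<in> X}"
    let ?H = "G\<lparr>arcs := arcs G - ?F\<rparr>"
    assume "\<not> k \<le> card ?F"
    then have sc: "strongly_connected ?H"
      using L unfolding arc_strong_def by auto
    from X obtain u v where uv: "u \<in> verts G" "u \<notin> X" "v \<in> X" "v \<in> verts G" by blast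
    with sc have "(u, v) \<in> rtrancl_on (verts ?H) (arcs_ends ?H)"
      by (simp add: strongly_connected_def reachable_def)
    then have "v \<notin> X"
      using uv(2) by (induct rule: rtrancl_on_induct) (auto simp: arcs_ends_conv)
    with uv show False by simp
  qed
next
  assume R: "digraph G \<and> verts G \<noteq> {} \<and> ?C"
  then interpret digraph G by simp
  show ?L unfolding arc_strong_def
  proof (intro conjI allI impI)
    show "digraph G" by (rule R[THEN conjunct1])
    fix F assume F: "F \<subseteq> arcs G" "card F < k"
    let ?H = "G\<lparr>arcs := arcs G - F\<rparr>"
    have "u \<rightarrow>\<^sup>*\<^bsub>?H\<^esub> v" if uv: "u \<in> verts G" "v \<in> verts G" for u v
    proof (rule ccontr)
      assume nr: "\<not> u \<rightarrow>\<^sup>*\<^bsub>?H\<^esub> v"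
      interpret H: wf_digraph ?H by unfold_locales auto
      define X where "X = {w \<in> verts G. \<not> u \<rightarrow>\<^sup>*\<^bsub>?H\<^esub> w}"
      have uu: "u \<rightarrow>\<^sup>*\<^bsub>?H\<^esub> u" using uv by (intro H.reachable_refl) simp
      have X: "X \<noteq> {} \<and> X \<subset> verts G" using uv nr uu unfolding X_def by blast
      let ?B = "{a \<in> arcs G. tail G a \<notin> X \<and> head G a \<in> X}"
      have k: "k \<le> card ?B" using R[THEN conjunct2, THEN conjunct2] X by simp
      have "a \<in> F" if a: "a \<in> arcs G" "tail G a \<notin> X" "head G a \<in> X" for a
      proof (rule ccontr)
        assume "a \<notin> F"
        with a(1) have "tail G a \<rightarrow>\<^bsub>?H\<^esub> head G a" by (auto simp: arcs_ends_conv)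
        moreover have "u \<rightarrow>\<^sup>*\<^bsub>?H\<^esub> tail G a"
          using a(2) tail_in_verts[OF a(1)] by (simp add: X_def)
        ultimately have "u \<rightarrow>\<^sup>*\<^bsub>?H\<^esub> head G a"
          by (rule H.reachable_adj_trans[rotated])
        with a(3) show False by (simp add: X_def)
      qed
      then have "?B \<subseteq> F" by blast
      moreover have "finite F" using F(1) finite_arcs by (rule finite_subset)
      ultimately have "card ?B \<le> card F" by (intro card_mono)
      with k F(2) show False by linarith
    qed
    with R show "strongly_connected ?H" by (simp add: strongly_connected_def)
  qed
qed

end

theory Submission
  imports Defs
begin

text \<open>
  Take the complete digraph on \<open>U \<union> W\<close> with \<open>U = {0, \<dots>, 2k}\<close>, delete the Hamiltonian path
  \<open>0, 1, \<dots>, 2k\<close> of \<open>U\<close>, and delete all arcs from \<open>W\<close> to \<open>U\<close> except those from one vertex of \<open>W\<close>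
  to the \<open>2k - 1\<close> inner vertices of the path. Every vertex of \<open>U\<close> then has in-degree exactly
  \<open>2k - 1\<close>. In an oriented subdigraph only one arc of each of the \<open>k(2k - 1)\<close> directed 2-cycles
  inside \<open>U\<close> survives, so the in-degrees in \<open>U\<close> sum to at most
  \<open>k(2k - 1) + (2k - 1) < k(2k + 1)\<close>, and some vertex of \<open>U\<close> has in-degree less than \<open>k\<close>.
  For the cut condition, an \<open>s\<close>-subset of \<open>U\<close> contains at most \<open>s(s - 1)\<close> arcs, so at least
  \<open>s(2k - s)\<close> arcs enter it; this suffices unless \<open>s \<ge> 2k\<close>.
  As the path alternates between even and odd vertices, the two parity classes stay semicomplete.
\<close>

section \<open>The digraphs and their arcs\<close>

definition gap_arcs :: "nat \<Rightarrow> nat rel" where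
  "gap_arcs m = {(x, y). x \<le> m \<and> y \<le> m \<and> x \<noteq> y \<and> x \<noteq> Suc y \<and> y \<noteq> Suc x}"

text \<open>The set W of the construction is \<open>{2 * k + 1..2 * k + n}\<close>, with
  \<open>2 * k + 1\<close> as the one vertex sending arcs back to U. The free parameter
  \<open>n\<close> is the size of W and makes the family infinite.\<close>

definition witness :: "nat \<Rightarrow> nat \<Rightarrow> nat pair_pre_digraph" where
  "witness k n = \<lparr>pverts = {..2 * k + n},
     parcs = gap_arcs (2 * k) \<union> {..2 * k} \<times> {2 * k + 1..2 * k + n}
       \<union> {(x, y). x \<in> {2 * k + 1..2 * k + n} \<and> y \<in> {2 * k + 1..2 * k + n} \<and> x \<noteq> y}
       \<union> {2 * k + 1} \<times> {0<..<2 * k}\<rparr>"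

lemma witness_verts [simp]: "pverts (witness k n) = {..2 * k + n}"
  by (simp add: witness_def)

lemma witness_arc_iff:
  "(x, y) \<in> parcs (witness k n) \<longleftrightarrow>
     (x \<le> 2 * k \<and> y \<le> 2 * k \<and> x \<noteq> y \<and> x \<noteq> Suc y \<and> y \<noteq> Suc x) \<or>
     (x \<le> 2 * k \<and> 2 * k < y \<and> y \<le> 2 * k + n) \<or>
     (2 * k < x \<and> x \<le> 2 * k + n \<and> 2 * k < y \<and> y \<le> 2 * k + n \<and> x \<noteq> y) \<or>
     (x = Suc (2 * k) \<and> 0 < y \<and> y < 2 * k)"
  by (auto simp: witness_def gap_arcs_def)

text \<open>Only consecutive vertices of the path lack this arc. Hence both the semicompleteness of
  S and that of the two parity classes follow from it.\<close>

lemma witness_arc_increasing: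
  assumes "x < y" "y \<le> 2 * k + n" "y \<noteq> Suc x \<or> 2 * k < y"
  shows "(x, y) \<in> parcs (witness k n)"
  using assms by (cases "y \<le> 2 * k"; cases "x \<le> 2 * k") (simp_all add: witness_arc_iff)

lemma finite_gap_arcs: "finite (gap_arcs m)"
  by (rule finite_subset[of _ "{..m} \<times> {..m}"]) (auto simp: gap_arcs_def)

text \<open>The new vertex \<open>Suc m\<close> is joined in both directions to every old vertex
  except \<open>m\<close>, its neighbour on the path, so each step adds 2m arcs.\<close>

lemma card_gap_arcs: "card (gap_arcs m) = m * (m - 1)"
proof (induction m)
  case 0
  have "gap_arcs 0 = {}" by (auto simp: gap_arcs_def)
  then show ?case by simp
next
  case (Suc m)
  have eq: "gap_arcs (Suc m) = gap_arcs m \<union> ({..<m} \<times> {Suc m} \<union> {Suc m} \<times> {..<m})"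
    by (auto simp: gap_arcs_def)
  have "card (gap_arcs (Suc m)) = card (gap_arcs m) + (m + m)"
    unfolding eq
    by (subst card_Un_disjoint, simp_all add: finite_gap_arcs, force simp: gap_arcs_def,
        subst card_Un_disjoint) (auto simp: card_cartesian_product)
  with Suc.IH show ?case by (cases m) auto
qed

lemma digraph_with_proj:
  assumes "finite (pverts G)" "parcs G \<subseteq> pverts G \<times> pverts G" "\<And>x. (x, x) \<notin> parcs G"
  shows "digraph (with_proj G)"
proof
  show "finite (arcs (with_proj G))"
    using assms(1,2) by (auto intro: finite_subset)
qed (use assms in \<open>auto simp: arc_to_ends_def\<close>)

lemma digraph_witness:
  assumes "n \<ge> 1"
  shows "digraph (with_proj (witness k n))"
  using assms by (intro digraph_with_proj) (auto simp: witness_arc_iff)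

section \<open>In-degrees and cuts\<close>

lemma card_in_arcs_witness:
  assumes "k \<ge> 1" "y \<le> 2 * k"
  shows "card {a \<in> parcs (witness k n). snd a = y} = 2 * k - 1"
proof -
  \<comment> \<open>An inner vertex misses two path neighbours but gains the arc from
    \<open>2 * k + 1\<close>; an end of the path misses one and gains none. At \<open>y = 0\<close>
    truncated subtraction gives \<open>y - 1 = y\<close>, and at \<open>y = 2 * k\<close> the
    element \<open>y + 1\<close> lies outside the range.\<close>
  have eq: "{a \<in> parcs (witness k n). snd a = y}
    = (if 0 < y \<and> y < 2 * k then insert (2 * k + 1) ({..2 * k} - {y - 1, y, y + 1})
       else {..2 * k} - {y - 1, y, y + 1}) \<times> {y}" (is "_ = ?A \<times> {y}")
    using assms by (auto simp: witness_arc_iff)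
  have "card ?A = 2 * k - 1"
  proof (cases "0 < y \<and> y < 2 * k")
    case True
    then have "card {y - 1, y, y + 1} = 3" by (cases y) auto
    with True have "card ({..2 * k} - {y - 1, y, y + 1}) = 2 * k + 1 - 3"
      by (subst card_Diff_subset) auto
    with True assms show ?thesis by (auto simp: Suc_diff_le)
  next
    case False
    then have "{..2 * k} - {y - 1, y, y + 1}
        = {..2 * k} - (if y = 0 then {0, 1} else {2 * k - 1, 2 * k})"
      using assms by auto
    then have "card ({..2 * k} - {y - 1, y, y + 1}) = 2 * k + 1 - 2"
      using assms by (auto simp: card_Diff_subset)
    with False show ?thesis by auto
  qed
  then show ?thesis by (simp add: eq card_cartesian_product)
qed

text \<open>This is (a - 1)(b - 1) \<ge> 0. It turns a product of the sizes of two sides into a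
  bound by their sum.\<close>

lemma pred_add_le_mult:
  fixes a b :: nat
  assumes "a \<ge> 1" "b \<ge> 1"
  shows "a + b - 1 \<le> a * b"
  using assms by (cases a; cases b) auto

lemma witness_cut_in_path:
  assumes k: "k \<ge> 2" and X: "X \<noteq> {}" "X \<subseteq> {..2 * k}"
  shows "2 * k - 1 \<le> card {a \<in> parcs (witness k n). fst a \<notin> X \<and> snd a \<in> X}"
    (is "_ \<le> card ?cut")
proof -
  have finX: "finite X" using X(2) by (rule finite_subset) simp
  have fin: "finite ?cut"
    by (rule finite_subset[of _ "{..2 * k + n + 1} \<times> X"]) (auto simp: witness_arc_iff finX)
  define s where "s = card X"
  have s: "s \<ge> 1" using X(1) finX by (simp add: s_def Suc_le_eq card_gt_0_iff)
  have "s \<le> 2 * k + 1" using card_mono[OF _ X(2)] by (simp add: s_def)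
  then consider "s \<le> 2 * k - 1" | "s = 2 * k" | "s = 2 * k + 1" by linarith
  then show ?thesis
  proof cases
    case 1
    define into where "into y = {a \<in> parcs (witness k n). snd a = y}" for y
    \<comment> \<open>An infinite set would have cardinality 0, but here it is 2k - 1 > 0.\<close>
    have fi: "finite (into y)" if "y \<in> X" for y
      using card_in_arcs_witness[of k y n] that X(2) k
      by (intro card_ge_0_finite) (auto simp: into_def)
    have "s * (2 * k - 1) = (\<Sum>y\<in>X. card (into y))"
    proof -
      have "card (into y) = 2 * k - 1" if "y \<in> X" for y
        using card_in_arcs_witness[of k y n] that X(2) k by (auto simp: into_def)
      then show ?thesis by (simp add: s_def)
    qed
    also have "\<dots> = card (\<Union>y\<in>X. into y)"
      using fi finX by (subst card_UN_disjoint) (auto simp: into_def)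
    \<comment> \<open>An arc ending in \<open>X\<close> either enters from outside or is a non-loop
      pair inside \<open>X\<close>.\<close>
    also have "\<dots> \<le> card (?cut \<union> (X \<times> X - Id_on X))"
      using fin finX by (intro card_mono) (auto simp: into_def witness_arc_iff)
    also have "\<dots> \<le> card ?cut + card (X \<times> X - Id_on X)" by (rule card_Un_le)
    also have "card (X \<times> X - Id_on X) = s * s - s"
    proof -
      have "Id_on X = (\<lambda>x. (x, x)) ` X" by auto
      then have "card (Id_on X) = s" "finite (Id_on X)"
        using finX by (auto simp: s_def card_image inj_on_def)
      moreover have "Id_on X \<subseteq> X \<times> X" by auto
      ultimately show ?thesis by (simp add: card_Diff_subset card_cartesian_product s_def)
    qed
    finally have le: "s * (2 * k - 1) \<le> card ?cut + (s * s - s)" .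
    obtain t where t: "2 * k = s + t" "t \<ge> 1" using 1 s that[of "2 * k - s"] by linarith
    have "s * (2 * k - 1) = s * t + (s * s - s)"
      using s t by (cases s) (auto simp: algebra_simps)
    with le have "s * t \<le> card ?cut" by linarith
    with pred_add_le_mult[OF s t(2)] t show ?thesis by linarith
  next
    case 2
    have "card ({..2 * k} - X) = 1"
      using 2 X(2) finX by (simp add: card_Diff_subset s_def)
    then obtain m where m: "{..2 * k} - X = {m}" by (auto simp: card_1_singleton_iff)
    then have Xm: "X = {..2 * k} - {m}" "m \<le> 2 * k" using X(2) by auto
    \<comment> \<open>If \<open>m\<close> is an inner vertex, the arc from \<open>2 * k + 1\<close>
      to \<open>m\<close> does not enter \<open>X\<close>. The arc from \<open>m\<close> to a vertex
      \<open>y\<close> not adjacent to it on the path makes up for this loss.\<close>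
    obtain y where y: "y \<le> 2 * k" "y \<noteq> m" "y \<noteq> Suc m" "m \<noteq> Suc y"
    proof (cases "m \<le> 1")
      case True
      with k show ?thesis by (intro that[of "m + 2"]) auto
    next
      case False
      with Xm k show ?thesis by (intro that[of "m - 2"]) auto
    qed
    have "2 * k - 1 - 1 \<le> card ({0<..<2 * k} - {m})"
      using diff_card_le_card_Diff[of "{m}" "{0<..<2 * k}"] by simp
    then have "2 * k - 1 \<le> card (insert (m, y) ({2 * k + 1} \<times> ({0<..<2 * k} - {m})))"
      using Xm(2) by (subst card_insert_disjoint) (auto simp: card_cartesian_product)
    also have "\<dots> \<le> card ?cut"
      using Xm y by (intro card_mono[OF fin]) (auto simp: witness_arc_iff)
    finally show ?thesis .
  next
    case 3
    then have "X = {..2 * k}" using X(2) by (intro card_subset_eq) (auto simp: s_def)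
    then have "{2 * k + 1} \<times> {0<..<2 * k} \<subseteq> ?cut" by (auto simp: witness_arc_iff)
    from card_mono[OF fin this] show ?thesis by (simp add: card_cartesian_product)
  qed
qed

lemma arc_strong_witness:
  assumes k: "k \<ge> 2" and n: "n \<ge> 2 * k"
  shows "arc_strong (2 * k - 1) (with_proj (witness k n))"
proof -
  let ?W = "{2 * k + 1..2 * k + n}"
  have "2 * k - 1 \<le> card {a \<in> parcs (witness k n). fst a \<notin> X \<and> snd a \<in> X}"
    (is "_ \<le> card ?cut") if X: "X \<noteq> {}" "X \<subset> {..2 * k + n}" for X
  proof -
    have fin: "finite ?cut"
      using digraph_witness[of n k] k n
      by (auto simp: digraph_def fin_digraph_def fin_digraph_axioms_def)
    \<comment> \<open>If \<open>X\<close> contains W, each vertex outside \<open>X\<close> lies in U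
      and sends \<open>n\<close> arcs to W. If \<open>X\<close> splits W, the complete digraph on W
      contributes at least n - 1 arcs, which is where \<open>n \<ge> 2 * k\<close> is sharp.\<close>
    consider "X \<subseteq> {..2 * k}" | "?W \<subseteq> X" | "X \<inter> ?W \<noteq> {}" "?W - X \<noteq> {}"
      using X by fastforce
    then show ?thesis
    proof cases
      case 1
      with witness_cut_in_path[OF k X(1)] show ?thesis by blast
    next
      case 2
      from X(2) obtain m where m: "m \<le> 2 * k + n" "m \<notin> X" by auto
      with 2 have "m \<notin> ?W" by blast
      with m(1) have "m \<le> 2 * k" by simp
      with m 2 have "{m} \<times> ?W \<subseteq> ?cut" by (auto simp: witness_arc_iff)
      from card_mono[OF fin this] n show ?thesis by (simp add: card_cartesian_product)
    next
      case 3
      have "(?W - X) \<times> (X \<inter> ?W) \<subseteq> ?cut" by (auto simp: witness_arc_iff)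
      from card_mono[OF fin this]
      have le: "card (?W - X) * card (X \<inter> ?W) \<le> card ?cut"
        by (simp add: card_cartesian_product)
      have "card (?W - X) + card (X \<inter> ?W) = n"
        using card_Diff_subset_Int[of ?W X] card_mono[of ?W "X \<inter> ?W"]
        by (simp add: Int_commute)
      moreover have "card (?W - X) \<ge> 1" "card (X \<inter> ?W) \<ge> 1"
        using 3 by (simp_all add: Suc_le_eq card_gt_0_iff)
      ultimately show ?thesis using pred_add_le_mult[of "card (?W - X)" "card (X \<inter> ?W)"] le n
        by linarith
    qed
  qed
  then show ?thesis
    using digraph_witness[of n k] k n by (subst arc_strong_iff_cuts) auto
qed

section \<open>No k-arc-strong spanning oriented subdigraph\<close>

lemma card_antisymmetric_le:
  assumes "finite B" "F \<subseteq> B" "F\<inverse> \<subseteq> B" "F \<inter> F\<inverse> = {}"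
  shows "2 * card F \<le> card B"
proof -
  have "card (F \<union> F\<inverse>) = card F + card F"
    using assms by (subst card_Un_disjoint) (auto intro: finite_subset)
  with card_mono[of B "F \<union> F\<inverse>"] assms show ?thesis by simp
qed

lemma witness_no_oriented:
  assumes k: "k \<ge> 2" and sp: "spanning H (with_proj (witness k n))"
    and ori: "oriented_graph H" and str: "arc_strong k H"
  shows False
proof -
  from sp have H: "arcs H \<subseteq> parcs (witness k n)" "tail H = fst" "head H = snd"
    "verts H = {..2 * k + n}"
    by (auto simp: spanning_def subgraph_def compatible_def)
  define F where "F = arcs H \<inter> gap_arcs (2 * k)"
  have "F \<inter> F\<inverse> = {}"
    using ori H(2,3) by (force simp: F_def oriented_graph_def arcs_ends_conv)
  moreover have "F\<inverse> \<subseteq> gap_arcs (2 * k)" by (auto simp: F_def gap_arcs_def)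
  ultimately have "2 * card F \<le> 2 * k * (2 * k - 1)"
    using card_antisymmetric_le[OF finite_gap_arcs, of F] by (auto simp: F_def card_gap_arcs)
  then have cF: "card F \<le> k * (2 * k - 1)" by simp
  have finA: "finite (arcs H)"
    using ori by (simp add: oriented_graph_def digraph_def fin_digraph_def fin_digraph_axioms_def)
  have "k \<le> card {a \<in> arcs H. snd a = y}" if y: "y \<le> 2 * k" for y
  proof -
    have "{y} \<subseteq> verts H" using y H(4) by simp
    \<comment> \<open>A second vertex makes the singleton a proper subset, so the cut condition
      bounds the in-degree of \<open>y\<close>.\<close>
    moreover have "(if y = 0 then 1 else 0) \<in> verts H - {y}" using k H(4) by simp
    ultimately have proper: "{y} \<noteq> {} \<and> {y} \<subset> verts H" by blast
    have "\<forall>X. X \<noteq> {} \<and> X \<subset> verts H \<longrightarrow>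
        k \<le> card {a \<in> arcs H. tail H a \<notin> X \<and> head H a \<in> X}"
      using str k arc_strong_iff_cuts[of k H] by simp
    then have "k \<le> card {a \<in> arcs H. tail H a \<notin> {y} \<and> head H a \<in> {y}}"
      using proper by blast
    also have "\<dots> \<le> card {a \<in> arcs H. snd a = y}"
      using finA H(3) by (intro card_mono) auto
    finally show ?thesis .
  qed
  then have "(\<Sum>y\<le>2 * k. k) \<le> (\<Sum>y\<le>2 * k. card {a \<in> arcs H. snd a = y})"
    by (intro sum_mono) auto
  also have "\<dots> = card (\<Union>y\<le>2 * k. {a \<in> arcs H. snd a = y})"
    using finA by (subst card_UN_disjoint) auto
  \<comment> \<open>No vertex of W other than \<open>2 * k + 1\<close> sends arcs to U.\<close>
  also have "\<dots> \<le> card (F \<union> {2 * k + 1} \<times> {0<..<2 * k})"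
    using H(1) finA by (intro card_mono) (auto simp: F_def gap_arcs_def witness_arc_iff)
  also have "\<dots> \<le> card F + (2 * k - 1)"
    using card_Un_le[of F "{2 * k + 1} \<times> {0<..<2 * k}"] by (simp add: card_cartesian_product)
  \<comment> \<open>The two sides contradict each other by exactly one: k(2k + 1) - k(2k - 1) =
    2k.\<close>
  finally have "(2 * k + 1) * k \<le> k * (2 * k - 1) + (2 * k - 1)" using cF by simp
  with k show False by (cases k) (auto simp: algebra_simps)
qed

section \<open>Semicompleteness and the deleted path\<close>

lemma semicomplete_induce_subgraph:
  assumes "digraph G" "A \<subseteq> verts G"
    and adj: "\<And>x y. x \<in> A \<Longrightarrow> y \<in> A \<Longrightarrow> x \<noteq> y \<Longrightarrow> x \<rightarrow>\<^bsub>G\<^esub> y \<or> y \<rightarrow>\<^bsub>G\<^esub> x"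
  shows "semicomplete (G \<restriction> A)"
proof -
  interpret digraph G by fact
  have "x \<rightarrow>\<^bsub>G \<restriction> A\<^esub> y" if "x \<in> A" "y \<in> A" "x \<rightarrow>\<^bsub>G\<^esub> y" for x y
    using that by (auto simp: arcs_ends_conv)
  then show ?thesis
    unfolding semicomplete_def
    using adj digraphI_induced[OF induced_induce[OF assms(2)]] by simp blast
qed

lemma set_vwalk_arcs_upt: "set (vwalk_arcs [0..<Suc m]) = {(i, Suc i) | i. i < m}"
proof (induction m)
  case (Suc m)
  have "vwalk_arcs [0..<Suc (Suc m)] = vwalk_arcs ([0..<Suc m] @ [Suc m])" by simp
  also have "set \<dots> = insert (m, Suc m) (set (vwalk_arcs [0..<Suc m]))"
    by (subst set_vwalk_arcs_snoc) auto
  finally show ?case using Suc.IH by (auto simp: less_Suc_eq)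
qed simp

lemma witness_delete_path:
  assumes n: "n \<ge> 1"
  shows "\<exists>S P. semicomplete (with_proj S) \<and>
    vpath P (with_proj (complete_graph_on (pverts S))) \<and>
    vwalk_length P \<ge> 2 * k \<and> witness k n = delete_path_arcs S P"
proof (intro exI conjI)
  let ?P = "[0..<Suc (2 * k)]"
  \<comment> \<open>S puts the path back in both directions. Since \<open>witness k n\<close> has no
    arc along the path, deleting it again restores the digraph exactly.\<close>
  let ?S = "\<lparr>pverts = {..2 * k + n},
    parcs = parcs (witness k n) \<union> symcl (set (vwalk_arcs ?P))\<rparr>"
  have sym: "(x, y) \<in> symcl (set (vwalk_arcs ?P)) \<longleftrightarrow>
      x \<le> 2 * k \<and> y \<le> 2 * k \<and> (x = Suc y \<or> y = Suc x)" for x y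
    unfolding set_vwalk_arcs_upt symcl_def by auto
  have "digraph (with_proj ?S)"
    using n by (intro digraph_with_proj) (auto simp: sym witness_arc_iff simp del: upt_Suc)
  moreover have "(x, y) \<in> parcs ?S" if "x < y" "y \<le> 2 * k + n" for x y
    using witness_arc_increasing[OF that] that
    by (cases "y = Suc x \<and> y \<le> 2 * k") (auto simp: sym simp del: upt_Suc)
  ultimately show "semicomplete (with_proj ?S)"
    unfolding semicomplete_def by (auto simp: neq_iff simp del: upt_Suc)
  show "vpath ?P (with_proj (complete_graph_on (pverts ?S)))"
    unfolding vpath_def vwalk_def set_vwalk_arcs_upt by (auto simp: complete_graph_on_def)
  show "2 * k \<le> vwalk_length ?P" by simp
  have "parcs (witness k n) \<inter> symcl (set (vwalk_arcs ?P)) = {}"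
    by (auto simp: sym witness_arc_iff simp del: upt_Suc)
  then show "witness k n = delete_path_arcs ?S ?P"
    unfolding delete_path_arcs_def
    by (intro pair_pre_digraph.equality) (auto simp del: upt_Suc)
qed

text \<open>The order is the invariant that separates the members of the family:
  \<open>witness k n\<close> has 2k + n + 1 vertices.\<close>

lemma digraph_iso_card_verts:
  assumes "digraph_iso G H"
  shows "card (verts H) = card (verts G)"
  using assms unfolding digraph_iso_def by auto

theorem theorem1p4:
  fixes k :: nat
  assumes "k \<ge> 2"
  shows "\<exists>\<D> :: nat pair_pre_digraph set.
    infinite_family \<D> \<and>
    (\<forall>D \<in> \<D>.
      arc_strong (2 * k - 1) (with_proj D) \<and>
      (\<exists>S P. semicomplete (with_proj S) \<and>
             vpath P (with_proj (complete_graph_on (pverts S))) \<and>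
             vwalk_length P \<ge> 2 * k \<and>
             D = delete_path_arcs S P) \<and>
      \<not> (\<exists>H. spanning H (with_proj D) \<and> oriented_graph H \<and> arc_strong k H) \<and>
      (\<exists>V\<^sub>1 V\<^sub>2. V\<^sub>1 \<noteq> {} \<and> V\<^sub>2 \<noteq> {} \<and> V\<^sub>1 \<inter> V\<^sub>2 = {} \<and> V\<^sub>1 \<union> V\<^sub>2 = pverts D \<and>
             semicomplete (with_proj D \<restriction> V\<^sub>1) \<and> semicomplete (with_proj D \<restriction> V\<^sub>2)))"
proof (rule exI[of _ "witness k ` {2 * k..}"], intro conjI ballI)
  let ?\<D> = "witness k ` {2 * k..}"
  have inj: "inj_on (witness k) {2 * k..}"
    by (rule inj_on_inverseI[where g = "\<lambda>D. card (pverts D) - 2 * k - 1"]) simp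
  have "infinite ?\<D>"
    using inj by (simp add: finite_image_iff infinite_Ici)
  moreover have "pairwise (\<lambda>G H. \<not> digraph_iso (with_proj G) (with_proj H)) ?\<D>"
    unfolding pairwise_def by (auto dest!: digraph_iso_card_verts)
  ultimately show "infinite_family ?\<D>" unfolding infinite_family_def by blast
  fix D assume "D \<in> ?\<D>"
  then obtain n where n: "n \<ge> 2 * k" and D: "D = witness k n" by auto
  have n1: "n \<ge> 1" using n assms by simp
  show "arc_strong (2 * k - 1) (with_proj D)"
    unfolding D using assms n by (rule arc_strong_witness)
  show "\<exists>S P. semicomplete (with_proj S) \<and>
      vpath P (with_proj (complete_graph_on (pverts S))) \<and>
      vwalk_length P \<ge> 2 * k \<and> D = delete_path_arcs S P"
    unfolding D using n1 by (rule witness_delete_path)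
  show "\<not> (\<exists>H. spanning H (with_proj D) \<and> oriented_graph H \<and> arc_strong k H)"
    unfolding D using witness_no_oriented[OF assms] by blast
  show "\<exists>V\<^sub>1 V\<^sub>2. V\<^sub>1 \<noteq> {} \<and> V\<^sub>2 \<noteq> {} \<and> V\<^sub>1 \<inter> V\<^sub>2 = {} \<and> V\<^sub>1 \<union> V\<^sub>2 = pverts D \<and>
      semicomplete (with_proj D \<restriction> V\<^sub>1) \<and> semicomplete (with_proj D \<restriction> V\<^sub>2)"
  proof (intro exI conjI)
    let ?E = "{x \<in> pverts D. even x}" and ?O = "{x \<in> pverts D. odd x}"
    have "0 \<in> ?E" "1 \<in> ?O" using n1 D by auto
    then show "?E \<noteq> {}" "?O \<noteq> {}" by blast+
    show "?E \<inter> ?O = {}" "?E \<union> ?O = pverts D" by auto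
    have "x \<rightarrow>\<^bsub>with_proj D\<^esub> y \<or> y \<rightarrow>\<^bsub>with_proj D\<^esub> x"
      if "x \<in> pverts D" "y \<in> pverts D" "even x = even y" "x \<noteq> y" for x y
    proof -
      \<comment> \<open>Consecutive numbers differ in parity, so the exception in
        \<open>witness_arc_increasing\<close> cannot occur.\<close>
      have "y \<noteq> Suc x" "x \<noteq> Suc y" using that(3) by auto
      with that show ?thesis
        using witness_arc_increasing[of x y k n] witness_arc_increasing[of y x k n]
        by (cases "x < y") (simp_all add: D)
    qed
    then show "semicomplete (with_proj D \<restriction> ?E)" "semicomplete (with_proj D \<restriction> ?O)"
      using digraph_witness[OF n1, of k] unfolding D[symmetric]
      by (auto intro!: semicomplete_induce_subgraph simp del: with_proj_simps(3))
  qed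
qed

end
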